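(* Let $k_{-1},k_0,k_1$ be nonnegative integers and $n=k_{-1}+k_0+k_1$. Suppose that $k_1+k_{-1}$ and $n$ are even and that $t$ is an odd integer. Then $$m(n,k_{-1},k_0,k_1,t)\ \ge\ \binom{n/2}{(k_1+k_{-1})/2}\binom{k_1+k_{-1}}{k_1}.$$
   Context: For nonnegative integers $k_{-1},k_0,k_1$ with $k_{-1}+k_0+k_1=n$, $V_n(k_{-1},k_0,k_1)$ is the set of vectors in $\{-1,0,1\}^n$ having exactly $k_{-1}$ coordinates equal to $-1$, exactly $k_0$ equal to $0$ and exactly $k_1$ equal to $1$. $(\mathbf x,\mathbf y)$ denotes the standard dot product. $m(n,k_{-1},k_0,k_1,t)$ is the maximum of $|W|$ over subsets $W\subset V_n(k_{-1},k_0,k_1)$ with $(\mathbf x,\mathbf y)\ne t$ for all distinct $\mathbf x,\mathbf y\in W$. *)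

theory Defs
  imports "HOL-Library.FuncSet"
begin

(* Vectors of length n are functions on {..<n} that are undefined outside {..<n}, so that
   distinct functions are distinct vectors. *)
definition V :: "nat \<Rightarrow> nat \<Rightarrow> nat \<Rightarrow> nat \<Rightarrow> (nat \<Rightarrow> int) set" where
  "V n km1 k0 k1 = {x \<in> {..<n} \<rightarrow>\<^sub>E {-1, 0, 1}.
     card {i \<in> {..<n}. x i = -1} = km1 \<and>
     card {i \<in> {..<n}. x i = 0} = k0 \<and>
     card {i \<in> {..<n}. x i = 1} = k1}"

definition dot :: "nat \<Rightarrow> (nat \<Rightarrow> int) \<Rightarrow> (nat \<Rightarrow> int) \<Rightarrow> int" where
  "dot n x y = (\<Sum>i<n. x i * y i)"

definition admissible :: "nat \<Rightarrow> nat \<Rightarrow> nat \<Rightarrow> nat \<Rightarrow> int \<Rightarrow> (nat \<Rightarrow> int) set set" where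
  "admissible n km1 k0 k1 t =
     {W. W \<subseteq> V n km1 k0 k1 \<and> (\<forall>x\<in>W. \<forall>y\<in>W. x \<noteq> y \<longrightarrow> dot n x y \<noteq> t)}"

definition m :: "nat \<Rightarrow> nat \<Rightarrow> nat \<Rightarrow> nat \<Rightarrow> int \<Rightarrow> nat" where
  "m n km1 k0 k1 t = Max (card ` admissible n km1 k0 k1 t)"

lemma finite_V: "finite (V n km1 k0 k1)"
proof -
  have "finite ({..<n} \<rightarrow>\<^sub>E {-1, 0, 1::int})"
    by (intro finite_PiE) auto
  then show ?thesis
    unfolding V_def by simp
qed

(* The Max in the definition of m is over a finite nonempty set. *)
lemma finite_admissible: "finite (admissible n km1 k0 k1 t)"
  by (rule finite_subset[of _ "Pow (V n km1 k0 k1)"])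
     (auto simp: admissible_def finite_V)

lemma empty_in_admissible: "{} \<in> admissible n km1 k0 k1 t"
  by (simp add: admissible_def)

end

theory Submission
  imports Defs
begin

text \<open>Group the coordinates into the pairs \<open>{2j, 2j+1}\<close> and take the vectors whose support is a union
of pairs. The product of two such vectors has the parity of the size of the intersection of their
supports, so it is even.\<close>

definition pairs_of :: "nat set \<Rightarrow> nat set" where
  "pairs_of S = {i. i div 2 \<in> S}"

text \<open>\<open>A\<close> is the intended support and \<open>P\<close>, a subset of
  \<open>A\<close>, holds the positions of the entries 1. Restricting to \<open>{..<n}\<close> gives
  the extensional functions that \<open>V\<close> asks for.\<close>

definition sign_vector :: "nat \<Rightarrow> nat set \<Rightarrow> nat set \<Rightarrow> nat \<Rightarrow> int" where
  "sign_vector n A P =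
     restrict (\<lambda>i. if i \<in> P then 1 else if i \<in> A then -1 else 0) {..<n}"

text \<open>Testing membership is easiest with \<open>div\<close>, while counting is easiest with
  two disjoint injective images, one of even and one of odd numbers.\<close>

lemma pairs_of_eq: "pairs_of S = (\<lambda>j. 2 * j) ` S \<union> (\<lambda>j. 2 * j + 1) ` S"
proof (intro set_eqI iffI)
  fix i assume "i \<in> pairs_of S"
  moreover have "i = 2 * (i div 2) \<or> i = 2 * (i div 2) + 1" by presburger
  ultimately show "i \<in> (\<lambda>j. 2 * j) ` S \<union> (\<lambda>j. 2 * j + 1) ` S"
    unfolding pairs_of_def by blast
qed (auto simp: pairs_of_def)

lemma finite_pairs_of: "finite S \<Longrightarrow> finite (pairs_of S)"
  by (simp add: pairs_of_eq)

lemma card_pairs_of: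
  assumes "finite S"
  shows "card (pairs_of S) = 2 * card S"
proof -
  have "(\<lambda>j. 2 * j) ` S \<inter> (\<lambda>j. 2 * j + 1) ` S = {}"
    by (auto; presburger)
  then have "card (pairs_of S) = card ((\<lambda>j. 2 * j) ` S) + card ((\<lambda>j. 2 * j + 1) ` S)"
    using assms unfolding pairs_of_eq by (intro card_Un_disjoint) auto
  also have "\<dots> = 2 * card S"
    by (simp add: card_image inj_on_def)
  finally show ?thesis .
qed

lemma pairs_of_subset: "S \<subseteq> {..<h} \<Longrightarrow> pairs_of S \<subseteq> {..<2 * h}"
  by (auto simp: pairs_of_def)

lemma sign_vector_in_V:
  assumes "P \<subseteq> A" "A \<subseteq> {..<n}"
  shows "sign_vector n A P \<in> V n (card A - card P) (n - card A) (card P)"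
proof -
  have fin: "finite A" "finite P"
    using assms by (meson finite_lessThan finite_subset)+
  have "{i \<in> {..<n}. sign_vector n A P i = -1} = A - P"
       "{i \<in> {..<n}. sign_vector n A P i = 0} = {..<n} - A"
       "{i \<in> {..<n}. sign_vector n A P i = 1} = P"
    using assms by (auto simp: sign_vector_def)
  moreover have "sign_vector n A P \<in> {..<n} \<rightarrow>\<^sub>E {-1, 0, 1}"
    by (auto simp: sign_vector_def)
  ultimately show ?thesis
    using fin assms by (simp add: V_def card_Diff_subset)
qed

text \<open>Support and positive positions can be read off from the values, since the inclusions in
  \<open>{..<n}\<close> keep the restriction from hiding any of them. This makes the counting of the
  family exact.\<close>

lemma sign_vector_eqD:
  assumes "sign_vector n A P = sign_vector n B Q"
    and "P \<subseteq> A" "A \<subseteq> {..<n}" "Q \<subseteq> B" "B \<subseteq> {..<n}"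
  shows "A = B \<and> P = Q"
proof -
  have "A = {i \<in> {..<n}. sign_vector n A P i \<noteq> 0}" "P = {i \<in> {..<n}. sign_vector n A P i = 1}"
       "B = {i \<in> {..<n}. sign_vector n B Q i \<noteq> 0}" "Q = {i \<in> {..<n}. sign_vector n B Q i = 1}"
    using assms(2-) by (auto simp: sign_vector_def split: if_splits)
  with assms(1) show ?thesis by metis
qed

lemma inj_pairs_of: "inj pairs_of"
proof (rule injI)
  fix S T assume eq: "pairs_of S = pairs_of T"
  have "j \<in> S \<longleftrightarrow> j \<in> T" for j
    \<comment> \<open>The even member of pair \<open>j\<close> already decides whether
      \<open>j\<close> belongs to the set.\<close>
    using eq[unfolded set_eq_iff, rule_format, of "2 * j"] by (simp add: pairs_of_def)
  then show "S = T" by blast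
qed

lemma sum_lessThan_double:
  "(\<Sum>i<2 * h. f i) = (\<Sum>j<h. f (2 * j) + f (2 * j + 1))" for f :: "nat \<Rightarrow> 'a::comm_monoid_add"
  by (induction h) (simp_all add: add.assoc)

text \<open>Within one pair both entries of a vector have the same parity, so the two products do
  too, and their sum is even. The signs are irrelevant.\<close>

lemma even_dot_sign_vector:
  assumes "P \<subseteq> pairs_of S" "Q \<subseteq> pairs_of T"
  shows "even (dot (2 * h) (sign_vector (2 * h) (pairs_of S) P) (sign_vector (2 * h) (pairs_of T) Q))"
proof -
  \<comment> \<open>Entries are 1 or -1 on the support and 0 off it. The bound \<open>j < h\<close>
    keeps both positions inside the restriction.\<close>
  have parity: "odd (sign_vector (2 * h) (pairs_of U) R (2 * j)) \<longleftrightarrow> j \<in> U"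
    "odd (sign_vector (2 * h) (pairs_of U) R (2 * j + 1)) \<longleftrightarrow> j \<in> U"
    if "R \<subseteq> pairs_of U" "j < h" for U R j
    using that by (auto simp: sign_vector_def pairs_of_def)
  show ?thesis
    unfolding dot_def sum_lessThan_double
    by (intro dvd_sum) (use parity[OF assms(1)] parity[OF assms(2)] in auto)
qed

lemma m_ge_card: "W \<in> admissible n km1 k0 k1 t \<Longrightarrow> card W \<le> m n km1 k0 k1 t"
  unfolding m_def by (intro Max_ge finite_imageI finite_admissible imageI)

theorem mainTheorem4:
  fixes km1 k0 k1 n :: nat and t :: int
  assumes "n = km1 + k0 + k1"
    and "even (k1 + km1)"
    and "even n"
    and "odd t"
  shows "m n km1 k0 k1 t \<ge> ((n div 2) choose ((k1 + km1) div 2)) * ((k1 + km1) choose k1)"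
proof -
  obtain h where h: "n = 2 * h" using \<open>even n\<close> by blast
  obtain s where s: "k1 + km1 = 2 * s" using \<open>even (k1 + km1)\<close> by blast
  \<comment> \<open>Choose \<open>s\<close> of the \<open>h\<close> pairs as support, then the
    \<open>k1\<close> positive positions among its \<open>2 * s\<close> coordinates. The number of
    second choices depends only on \<open>card S\<close>, so the count is a product.\<close>
  define I where "I = (SIGMA S:{S. S \<subseteq> {..<h} \<and> card S = s}. {P. P \<subseteq> pairs_of S \<and> card P = k1})"
  define F where "F = (\<lambda>(S, P). sign_vector n (pairs_of S) P)"
  have fin: "finite S" if "S \<subseteq> {..<h}" for S
    using that finite_subset by blast
  have "card I = (\<Sum>S\<in>{S. S \<subseteq> {..<h} \<and> card S = s}. card {P. P \<subseteq> pairs_of S \<and> card P = k1})"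
    unfolding I_def by (rule card_SigmaI) (auto simp: fin finite_pairs_of)
  also have "\<dots> = (\<Sum>S\<in>{S. S \<subseteq> {..<h} \<and> card S = s}. 2 * s choose k1)"
    by (intro sum.cong) (auto simp: n_subsets fin finite_pairs_of card_pairs_of)
  also have "\<dots> = (h choose s) * (2 * s choose k1)"
    by (simp add: n_subsets)
  finally have card_I: "card I = (h choose s) * (2 * s choose k1)" .
  have "inj_on F I"
  proof (rule inj_onI)
    fix p q assume pq: "p \<in> I" "q \<in> I" "F p = F q"
    obtain S P T Q where p: "p = (S, P)" and q: "q = (T, Q)" by (metis surj_pair)
    have "pairs_of S = pairs_of T \<and> P = Q"
      using pq unfolding p q by (intro sign_vector_eqD[of n]) (auto simp: F_def I_def h dest: pairs_of_subset)
    then show "p = q"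
      using injD[OF inj_pairs_of] by (simp add: p q)
  qed
  moreover have "F ` I \<subseteq> V n km1 k0 k1"
  proof
    fix x assume "x \<in> F ` I"
    then obtain S P where SP: "S \<subseteq> {..<h}" "card S = s" "P \<subseteq> pairs_of S" "card P = k1"
      and x: "x = sign_vector n (pairs_of S) P"
      by (auto simp: I_def F_def)
    have "card (pairs_of S) = k1 + km1"
      using SP s by (simp add: card_pairs_of fin)
    \<comment> \<open>The support has size \<open>k1 + km1\<close>, so the truncated differences in
      \<open>sign_vector_in_V\<close> come out as \<open>km1\<close> and \<open>k0\<close>.\<close>
    moreover have "n - (k1 + km1) = k0" using assms(1) by simp
    ultimately show "x \<in> V n km1 k0 k1"
      using sign_vector_in_V[OF SP(3), of n] pairs_of_subset[OF SP(1)] SP(4) h x by simp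
  qed
  \<comment> \<open>An even product cannot equal the odd number \<open>t\<close>, so the whole image
    is admissible.\<close>
  moreover have "even (dot n x y)" if "x \<in> F ` I" "y \<in> F ` I" for x y
    using that by (auto simp: I_def F_def h intro!: even_dot_sign_vector)
  ultimately have "F ` I \<in> admissible n km1 k0 k1 t"
    using \<open>odd t\<close> by (auto simp: admissible_def)
  from m_ge_card[OF this] show ?thesis
    using card_image[OF \<open>inj_on F I\<close>] card_I by (simp add: h s)
qed

end
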